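(* Let $\mathcal{E}$ be a category with images and pullbacks, let $E$ be an object of $\mathcal{E}$ whose lattice of subobjects is complete, and let $f:E\to E$ be an arbitrary endomorphism in $\mathcal{E}$. For a subobject $M$ of $E$ define $$\overline{M}:=\bigvee_{k\in\mathbb{N}}f^{k}(M)=M\vee f(M)\vee f^2(M)\vee\cdots.$$ Then for all subobjects $M,M'$ of $E$: (i) $M\leq\overline{M}$; (ii) $\overline{\overline{M}}=\overline{M}$; (iii) $\overline{M\vee M'}=\overline{M}\vee\overline{M'}$.
   Context: For a subobject $M$ of $E$, $f(M)$ denotes the image of $M$ under $f$ (direct image of subobjects); $f^k(M)$ denotes the image of $M$ under the $k$-fold composite $f^k$, with $f^0=\mathrm{id}_E$, and $0\in\mathbb{N}$. The symbols $\vee$ and $\bigvee$ denote joins in the lattice of subobjects of $E$. *)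

theory Defs
  imports "HOL-Algebra.Complete_Lattice"
begin

section \<open>Categories, monomorphisms, images, pullbacks\<close>

text \<open>Composition is written in the usual order: \<open>g \<cdot> f\<close> is \<open>g\<close> after \<open>f\<close>. Its value is
  unspecified when \<open>g\<close> and \<open>f\<close> are not composable.\<close>

record ('o, 'a) cat =
  Obj :: "'o set"
  Arr :: "'a set"
  Dom :: "'a \<Rightarrow> 'o"
  Cod :: "'a \<Rightarrow> 'o"
  Ident :: "'o \<Rightarrow> 'a"
  Comp :: "'a \<Rightarrow> 'a \<Rightarrow> 'a"  (infixr \<open>\<cdot>\<index>\<close> 70)

locale category =
  fixes C :: "('o, 'a) cat" (structure)
  assumes Dom_closed: "f \<in> Arr C \<Longrightarrow> Dom C f \<in> Obj C"
    and Cod_closed: "f \<in> Arr C \<Longrightarrow> Cod C f \<in> Obj C"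
    and Ident_Arr: "X \<in> Obj C \<Longrightarrow> Ident C X \<in> Arr C"
    and Ident_Dom: "X \<in> Obj C \<Longrightarrow> Dom C (Ident C X) = X"
    and Ident_Cod: "X \<in> Obj C \<Longrightarrow> Cod C (Ident C X) = X"
    and Comp_Arr: "\<lbrakk>f \<in> Arr C; g \<in> Arr C; Dom C g = Cod C f\<rbrakk> \<Longrightarrow> g \<cdot> f \<in> Arr C"
    and Comp_Dom: "\<lbrakk>f \<in> Arr C; g \<in> Arr C; Dom C g = Cod C f\<rbrakk> \<Longrightarrow> Dom C (g \<cdot> f) = Dom C f"
    and Comp_Cod: "\<lbrakk>f \<in> Arr C; g \<in> Arr C; Dom C g = Cod C f\<rbrakk> \<Longrightarrow> Cod C (g \<cdot> f) = Cod C g"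
    and Comp_Ident: "f \<in> Arr C \<Longrightarrow> f \<cdot> Ident C (Dom C f) = f"
    and Ident_Comp: "f \<in> Arr C \<Longrightarrow> Ident C (Cod C f) \<cdot> f = f"
    and Comp_assoc: "\<lbrakk>f \<in> Arr C; g \<in> Arr C; h \<in> Arr C; Dom C g = Cod C f; Dom C h = Cod C g\<rbrakk>
      \<Longrightarrow> (h \<cdot> g) \<cdot> f = h \<cdot> (g \<cdot> f)"

definition Hom :: "('o, 'a) cat \<Rightarrow> 'o \<Rightarrow> 'o \<Rightarrow> 'a set"
  where "Hom C X Y = {f \<in> Arr C. Dom C f = X \<and> Cod C f = Y}"

definition monic :: "('o, 'a) cat \<Rightarrow> 'a \<Rightarrow> bool"
  where "monic C m \<longleftrightarrow> m \<in> Arr C \<and>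
    (\<forall>X \<in> Obj C. \<forall>g \<in> Hom C X (Dom C m). \<forall>h \<in> Hom C X (Dom C m).
       m \<cdot>\<^bsub>C\<^esub> g = m \<cdot>\<^bsub>C\<^esub> h \<longrightarrow> g = h)"

definition factors_through :: "('o, 'a) cat \<Rightarrow> 'a \<Rightarrow> 'a \<Rightarrow> bool"
  where "factors_through C g m \<longleftrightarrow> (\<exists>h \<in> Hom C (Dom C g) (Dom C m). g = m \<cdot>\<^bsub>C\<^esub> h)"

definition monos_into :: "('o, 'a) cat \<Rightarrow> 'o \<Rightarrow> 'a set"
  where "monos_into C E = {m. monic C m \<and> Cod C m = E}"

text \<open>The image of \<open>g\<close> is the smallest subobject of its codomain through which \<open>g\<close> factors;
  no stability under pullback is required.\<close>

definition is_image :: "('o, 'a) cat \<Rightarrow> 'a \<Rightarrow> 'a \<Rightarrow> bool"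
  where "is_image C g m \<longleftrightarrow> m \<in> monos_into C (Cod C g) \<and> factors_through C g m \<and>
    (\<forall>n \<in> monos_into C (Cod C g). factors_through C g n \<longrightarrow> factors_through C m n)"

definition has_images :: "('o, 'a) cat \<Rightarrow> bool"
  where "has_images C \<longleftrightarrow> (\<forall>g \<in> Arr C. \<exists>m. is_image C g m)"

definition is_pullback :: "('o, 'a) cat \<Rightarrow> 'a \<Rightarrow> 'a \<Rightarrow> 'a \<Rightarrow> 'a \<Rightarrow> bool"
  where "is_pullback C f g p q \<longleftrightarrow> (\<exists>P \<in> Obj C.
    p \<in> Hom C P (Dom C f) \<and> q \<in> Hom C P (Dom C g) \<and> f \<cdot>\<^bsub>C\<^esub> p = g \<cdot>\<^bsub>C\<^esub> q \<and>
    (\<forall>X \<in> Obj C. \<forall>a \<in> Hom C X (Dom C f). \<forall>b \<in> Hom C X (Dom C g).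
       f \<cdot>\<^bsub>C\<^esub> a = g \<cdot>\<^bsub>C\<^esub> b \<longrightarrow> (\<exists>!u. u \<in> Hom C X P \<and> p \<cdot>\<^bsub>C\<^esub> u = a \<and> q \<cdot>\<^bsub>C\<^esub> u = b)))"

definition has_pullbacks :: "('o, 'a) cat \<Rightarrow> bool"
  where "has_pullbacks C \<longleftrightarrow>
    (\<forall>f \<in> Arr C. \<forall>g \<in> Arr C. Cod C f = Cod C g \<longrightarrow> (\<exists>p q. is_pullback C f g p q))"

section \<open>The ordered set of subobjects\<close>

definition mono_equiv :: "('o, 'a) cat \<Rightarrow> 'o \<Rightarrow> ('a \<times> 'a) set"
  where "mono_equiv C E = {(m, n). m \<in> monos_into C E \<and> n \<in> monos_into C E \<and>
    factors_through C m n \<and> factors_through C n m}"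

definition Sub :: "('o, 'a) cat \<Rightarrow> 'o \<Rightarrow> 'a set gorder"
  where "Sub C E = \<lparr>carrier = monos_into C E // mono_equiv C E, eq = (=),
    le = (\<lambda>M N. \<exists>m \<in> M. \<exists>n \<in> N. factors_through C m n)\<rparr>"

text \<open>The monomorphisms that are images of \<open>g \<cdot> m\<close>, for \<open>m\<close> ranging over the representatives of
  the subobject \<open>M\<close>, form exactly one equivalence class; see \<open>direct_image_eq_class\<close>
  and \<open>direct_image_closed\<close> below.\<close>

definition direct_image :: "('o, 'a) cat \<Rightarrow> 'a \<Rightarrow> 'a set \<Rightarrow> 'a set"
  where "direct_image C g M = {n. \<exists>m \<in> M. is_image C (g \<cdot>\<^bsub>C\<^esub> m) n}"

primrec arr_pow :: "('o, 'a) cat \<Rightarrow> 'o \<Rightarrow> 'a \<Rightarrow> nat \<Rightarrow> 'a"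
  where "arr_pow C E f 0 = Ident C E"
  | "arr_pow C E f (Suc k) = f \<cdot>\<^bsub>C\<^esub> arr_pow C E f k"

definition orbit_join :: "('o, 'a) cat \<Rightarrow> 'o \<Rightarrow> 'a \<Rightarrow> 'a set \<Rightarrow> 'a set"
  where "orbit_join C E f M = \<Squnion>\<^bsub>Sub C E\<^esub> (range (\<lambda>k::nat. direct_image C (arr_pow C E f k) M))"

section \<open>Direct images are well defined\<close>

context category
begin

lemma HomD: "f \<in> Hom C X Y \<Longrightarrow> f \<in> Arr C \<and> Dom C f = X \<and> Cod C f = Y"
  by (simp add: Hom_def)

lemma Hom_Comp: "\<lbrakk>f \<in> Hom C X Y; g \<in> Hom C Y Z\<rbrakk> \<Longrightarrow> g \<cdot> f \<in> Hom C X Z"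
  by (simp add: Hom_def Comp_Arr Comp_Dom Comp_Cod)

lemma monos_intoD: "m \<in> monos_into C E \<Longrightarrow> m \<in> Arr C \<and> Cod C m = E"
  by (simp add: monos_into_def monic_def)

lemma factors_refl:
  assumes "m \<in> Arr C" shows "factors_through C m m"
  unfolding factors_through_def
  using assms Comp_Ident Ident_Arr Ident_Dom Ident_Cod Dom_closed
  by (intro bexI[of _ "Ident C (Dom C m)"]) (auto simp: Hom_def)

lemma factors_trans:
  assumes "n \<in> Arr C" "p \<in> Arr C"
    and mn: "factors_through C m n" and np: "factors_through C n p"
  shows "factors_through C m p"
proof -
  obtain h where h: "h \<in> Hom C (Dom C m) (Dom C n)" "m = n \<cdot> h"
    using mn by (auto simp: factors_through_def)
  obtain k where k: "k \<in> Hom C (Dom C n) (Dom C p)" "n = p \<cdot> k"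
    using np by (auto simp: factors_through_def)
  have "m = p \<cdot> (k \<cdot> h)"
    using h k assms(2) HomD Comp_assoc[of h k p] by simp
  then show ?thesis
    unfolding factors_through_def using Hom_Comp[OF h(1) k(1)] by blast
qed

lemma factors_Comp:
  assumes "g \<in> Arr C" "n \<in> Arr C" "Cod C n = Dom C g" "factors_through C m n"
  shows "factors_through C (g \<cdot> m) (g \<cdot> n)"
proof -
  obtain h where h: "h \<in> Hom C (Dom C m) (Dom C n)" "m = n \<cdot> h"
    using assms(4) by (auto simp: factors_through_def)
  have "Dom C m = Dom C h" "h \<in> Arr C" "Cod C h = Dom C n" using HomD[OF h(1)] by auto
  then have "g \<cdot> m = (g \<cdot> n) \<cdot> h" "Dom C (g \<cdot> m) = Dom C m" "Dom C (g \<cdot> n) = Dom C n"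
    using h(2) assms Comp_assoc[of h n g] Comp_Dom[of n g] Comp_Dom[of m g] Comp_Arr[of h n]
      Comp_Cod[of h n] by auto
  then show ?thesis unfolding factors_through_def using h(1) by auto
qed

lemma equiv_mono_equiv: "equiv (monos_into C E) (mono_equiv C E)"
proof (rule equivI)
  show "mono_equiv C E \<subseteq> monos_into C E \<times> monos_into C E"
    by (auto simp: mono_equiv_def)
  show "refl_on (monos_into C E) (mono_equiv C E)"
    by (auto simp: refl_on_def mono_equiv_def dest: monos_intoD intro: factors_refl)
  show "sym (mono_equiv C E)"
    by (auto simp: sym_def mono_equiv_def)
  show "trans (mono_equiv C E)"
    by (rule transI) (auto simp: mono_equiv_def dest: monos_intoD intro: factors_trans)
qed

lemma direct_image_eq_class:
  assumes g: "g \<in> Hom C E F" and M: "M \<in> carrier (Sub C E)"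
    and m: "m \<in> M" and n: "is_image C (g \<cdot> m) n"
  shows "direct_image C g M = mono_equiv C F `` {n}"
proof -
  have Mm: "m' \<in> monos_into C E \<and> factors_through C m m' \<and> factors_through C m' m"
    if "m' \<in> M" for m'
  proof -
    have "M \<in> monos_into C E // mono_equiv C E" using M by (simp add: Sub_def)
    then have "(m, m') \<in> mono_equiv C E"
      using quotient_eq_iff[OF equiv_mono_equiv] m that by blast
    then show ?thesis by (simp add: mono_equiv_def)
  qed
  have cod: "g \<cdot> m' \<in> Arr C \<and> Cod C (g \<cdot> m') = F" if "m' \<in> M" for m'
    using Mm[OF that] monos_intoD HomD[OF g] Comp_Arr Comp_Cod by metis
  have fac: "factors_through C (g \<cdot> m') (g \<cdot> m'')" if "m' \<in> M" "m'' \<in> M" for m' m''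
  proof (rule factors_Comp)
    have "m \<in> Arr C" "m'' \<in> Arr C" using Mm m that monos_intoD by blast+
    then show "factors_through C m' m''" using Mm that factors_trans by blast
  qed (use Mm[OF that(2)] monos_intoD HomD[OF g] in auto)
  show ?thesis
  proof (intro equalityI subsetI)
    fix n' assume "n' \<in> direct_image C g M"
    then obtain m' where m': "m' \<in> M" "is_image C (g \<cdot> m') n'"
      by (auto simp: direct_image_def)
    have n1: "n \<in> monos_into C F" "n' \<in> monos_into C F"
      "factors_through C (g \<cdot> m) n" "factors_through C (g \<cdot> m') n'"
      using n m' m cod by (auto simp: is_image_def)
    have "factors_through C (g \<cdot> m) n'" "factors_through C (g \<cdot> m') n"
      using n1 factors_trans fac m m'(1) cod monos_intoD by meson+
    then have "factors_through C n n'" "factors_through C n' n"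
      using n m' n1 cod m by (auto simp: is_image_def)
    then show "n' \<in> mono_equiv C F `` {n}" using n1 by (simp add: mono_equiv_def)
  next
    fix n' assume "n' \<in> mono_equiv C F `` {n}"
    then have e: "n \<in> monos_into C F" "n' \<in> monos_into C F"
      "factors_through C n n'" "factors_through C n' n" by (auto simp: mono_equiv_def)
    have "is_image C (g \<cdot> m) n'"
      using n e cod[OF m] monos_intoD factors_trans unfolding is_image_def by metis
    then show "n' \<in> direct_image C g M" using m by (auto simp: direct_image_def)
  qed
qed

lemma direct_image_closed:
  assumes "has_images C" and g: "g \<in> Hom C E F" and M: "M \<in> carrier (Sub C E)"
  shows "direct_image C g M \<in> carrier (Sub C F)"
proof -
  have MQ: "M \<in> monos_into C E // mono_equiv C E" using M by (simp add: Sub_def)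
  obtain m where m: "m \<in> M" "m \<in> monos_into C E"
    using MQ in_quotient_imp_non_empty[OF equiv_mono_equiv MQ]
      in_quotient_imp_subset[OF equiv_mono_equiv MQ] by blast
  then have gm: "g \<cdot> m \<in> Arr C" "Cod C (g \<cdot> m) = F"
    using monos_intoD HomD[OF g] Comp_Arr Comp_Cod by metis+
  then obtain n where n: "is_image C (g \<cdot> m) n" using assms(1) by (auto simp: has_images_def)
  then have "n \<in> monos_into C F" using gm by (simp add: is_image_def)
  then show ?thesis
    unfolding direct_image_eq_class[OF g M m(1) n] Sub_def by (simp add: quotientI)
qed

end

end

theory Submission
  imports Defs
begin

text \<open>Call a subobject \<open>N\<close> of \<open>E\<close> invariant if \<open>f(N) \<le> N\<close>. The theorem holds because the join
  of the orbit of \<open>M\<close> is the least invariant subobject above \<open>M\<close>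
  (\<open>orbit_join_upper\<close>, \<open>orbit_join_invariant\<close>, \<open>orbit_join_least\<close>). This makes it a closure
  operator, so (i) and (ii) are immediate. For (iii), the join of two invariant subobjects is
  again invariant; hence the join of the two closures is invariant, and it is the least invariant
  subobject above both \<open>M\<close> and \<open>M'\<close>.

  That the orbit join and binary joins of invariant subobjects are invariant needs \<open>f\<close> to respect
  joins, and this is where pullbacks enter. By the universal property of images, \<open>f(M) \<le> N\<close>
  means that the arrow \<open>f \<cdot> m\<close> factors through \<open>n\<close>, for representatives \<open>m\<close> and \<open>n\<close>
  (\<open>direct_image_le_iff\<close>); by the universal property of the pullback \<open>p\<close> of \<open>n\<close> along \<open>f\<close>,
  that means that \<open>m\<close> factors through \<open>p\<close> (\<open>mono_pullback\<close>). So the direct image has the inverse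
  image as a right adjoint (\<open>direct_image_adjoint\<close>) and preserves joins. Pulling back the bound also
  gives \<open>f(g(M)) \<le> (f \<cdot> g)(M)\<close> (\<open>direct_image_Comp_le\<close>), which shifts the orbit by
  one step.\<close>

context category
begin

section \<open>Subobjects and their representatives\<close>

lemma Sub_rep:
  assumes "M \<in> carrier (Sub C E)"
  obtains m where "m \<in> M"
  using assms in_quotient_imp_non_empty[OF equiv_mono_equiv] by (fastforce simp: Sub_def)

lemma Sub_repD:
  assumes M: "M \<in> carrier (Sub C E)" and m: "m \<in> M"
  shows "m \<in> monos_into C E" "m \<in> Arr C" "Cod C m = E"
proof -
  have "M \<in> monos_into C E // mono_equiv C E" using M by (simp add: Sub_def)
  then show "m \<in> monos_into C E"
    using in_quotient_imp_subset[OF equiv_mono_equiv] m by blast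
  then show "m \<in> Arr C" "Cod C m = E" using monos_intoD by blast+
qed

lemma Sub_rep_factors:
  assumes M: "M \<in> carrier (Sub C E)" and m: "m \<in> M" "m' \<in> M"
  shows "factors_through C m m'"
proof -
  have "M \<in> monos_into C E // mono_equiv C E" using M by (simp add: Sub_def)
  then have "(m, m') \<in> mono_equiv C E"
    using quotient_eq_iff[OF equiv_mono_equiv] m by blast
  then show ?thesis by (simp add: mono_equiv_def)
qed

lemma Sub_le_iff:
  assumes M: "M \<in> carrier (Sub C E)" and N: "N \<in> carrier (Sub C E)"
    and m: "m \<in> M" and n: "n \<in> N"
  shows "M \<sqsubseteq>\<^bsub>Sub C E\<^esub> N \<longleftrightarrow> factors_through C m n"
proof
  assume "M \<sqsubseteq>\<^bsub>Sub C E\<^esub> N"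
  then obtain m' n' where mn: "m' \<in> M" "n' \<in> N" "factors_through C m' n'"
    by (auto simp: Sub_def)
  have "factors_through C m n'"
    using factors_trans[OF Sub_repD(2)[OF M mn(1)] Sub_repD(2)[OF N mn(2)]]
      Sub_rep_factors[OF M m mn(1)] mn(3) by blast
  then show "factors_through C m n"
    using factors_trans[OF Sub_repD(2)[OF N mn(2)] Sub_repD(2)[OF N n]]
      Sub_rep_factors[OF N mn(2) n] by blast
qed (use m n in \<open>auto simp: Sub_def\<close>)

lemma mono_class_Sub:
  assumes "m \<in> monos_into C E"
  shows "mono_equiv C E `` {m} \<in> carrier (Sub C E)" "m \<in> mono_equiv C E `` {m}"
  using assms equiv_class_self[OF equiv_mono_equiv assms] by (auto simp: Sub_def quotientI)

section \<open>Direct images and inverse images\<close>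

text \<open>This is the universal property of the image, freed from the choice of an image and of
  representatives; it turns every inequality about direct images below into a factorization of
  arrows.\<close>

lemma direct_image_le_iff:
  assumes im: "has_images C" and g: "g \<in> Hom C E F"
    and M: "M \<in> carrier (Sub C E)" and N: "N \<in> carrier (Sub C F)"
    and m: "m \<in> M" and n: "n \<in> N"
  shows "direct_image C g M \<sqsubseteq>\<^bsub>Sub C F\<^esub> N \<longleftrightarrow> factors_through C (g \<cdot> m) n"
proof -
  have gm: "g \<cdot> m \<in> Arr C" "Cod C (g \<cdot> m) = F"
    using Sub_repD[OF M m] HomD[OF g] Comp_Arr Comp_Cod by auto
  obtain i where i: "is_image C (g \<cdot> m) i"
    using im gm(1) by (auto simp: has_images_def)
  have iM: "i \<in> direct_image C g M" using i m by (auto simp: direct_image_def)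
  have DM: "direct_image C g M \<in> carrier (Sub C F)"
    by (rule direct_image_closed[OF im g M])
  have fi: "factors_through C (g \<cdot> m) i" using i by (simp add: is_image_def)
  have "factors_through C i n \<longleftrightarrow> factors_through C (g \<cdot> m) n"
    using factors_trans[OF Sub_repD(2)[OF DM iM] Sub_repD(2)[OF N n] fi]
      i gm Sub_repD(1)[OF N n] by (auto simp: is_image_def)
  then show ?thesis using Sub_le_iff[OF DM N iM n] by simp
qed

lemma mono_pullback:
  assumes pb: "has_pullbacks C" and g: "g \<in> Hom C E F" and n: "n \<in> monos_into C F"
  obtains p where "p \<in> monos_into C E"
    "\<And>a. \<lbrakk>a \<in> Arr C; Cod C a = E\<rbrakk> \<Longrightarrow> factors_through C a p \<longleftrightarrow> factors_through C (g \<cdot> a) n"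
proof -
  have gA: "g \<in> Arr C" "Dom C g = E" "Cod C g = F" using HomD[OF g] by auto
  have nA: "n \<in> Arr C" "Cod C n = F" using monos_intoD[OF n] by auto
  obtain p q where "is_pullback C g n p q"
    using pb gA nA unfolding has_pullbacks_def by metis
  then obtain P where P: "P \<in> Obj C" "p \<in> Hom C P E" "q \<in> Hom C P (Dom C n)" "g \<cdot> p = n \<cdot> q"
    and univ: "\<And>X a b. \<lbrakk>X \<in> Obj C; a \<in> Hom C X E; b \<in> Hom C X (Dom C n); g \<cdot> a = n \<cdot> b\<rbrakk>
      \<Longrightarrow> \<exists>!u. u \<in> Hom C X P \<and> p \<cdot> u = a \<and> q \<cdot> u = b"
    unfolding is_pullback_def gA by blast
  have pA: "p \<in> Arr C" "Dom C p = P" "Cod C p = E" using HomD[OF P(2)] by auto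
  have qA: "q \<in> Arr C" "Dom C q = P" "Cod C q = Dom C n" using HomD[OF P(3)] by auto
  have square: "g \<cdot> (p \<cdot> u) = n \<cdot> (q \<cdot> u)" if "u \<in> Hom C X P" for u X
    using HomD[OF that] Comp_assoc[of u p g] Comp_assoc[of u q n] P(4) pA qA gA nA by auto
  have "monic C p"
    unfolding monic_def pA
  proof (intro conjI ballI impI)
    fix X h k assume X: "X \<in> Obj C" and h: "h \<in> Hom C X P" and k: "k \<in> Hom C X P"
      and eq: "p \<cdot> h = p \<cdot> k"
    have qh: "q \<cdot> h \<in> Hom C X (Dom C n)" and qk: "q \<cdot> k \<in> Hom C X (Dom C n)"
      using Hom_Comp P(3) h k by blast+
    \<comment> \<open>Since \<open>n\<close> is monic, agreement after \<open>p\<close> forces agreement after \<open>q\<close>, so both arrows are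
      the mediating arrow of the same cone.\<close>
    have "n \<cdot> (q \<cdot> h) = n \<cdot> (q \<cdot> k)" using square[OF h] square[OF k] eq by simp
    then have "q \<cdot> h = q \<cdot> k"
      using n X qh qk by (auto simp: monos_into_def monic_def)
    then show "h = k"
      using univ[OF X Hom_Comp[OF h P(2)] qh square[OF h]] h k eq by auto
  qed (use pA in simp)
  then have "p \<in> monos_into C E" using pA by (simp add: monos_into_def)
  moreover have "factors_through C a p \<longleftrightarrow> factors_through C (g \<cdot> a) n"
    if a: "a \<in> Arr C" "Cod C a = E" for a
  proof
    have dom: "Dom C (g \<cdot> a) = Dom C a" using Comp_Dom a gA by simp
    {
      assume "factors_through C a p"
      then obtain u where u: "u \<in> Hom C (Dom C a) P" "a = p \<cdot> u"
        by (auto simp: factors_through_def pA)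
      then show "factors_through C (g \<cdot> a) n"
        unfolding factors_through_def dom
        using square[OF u(1)] Hom_Comp[OF u(1) P(3)] by auto
    next
      assume "factors_through C (g \<cdot> a) n"
      then obtain b where b: "b \<in> Hom C (Dom C a) (Dom C n)" "g \<cdot> a = n \<cdot> b"
        by (auto simp: factors_through_def dom)
      have "a \<in> Hom C (Dom C a) E" using a by (simp add: Hom_def)
      then show "factors_through C a p"
        using univ[OF Dom_closed[OF a(1)] _ b] unfolding factors_through_def pA by blast
    }
  qed
  ultimately show thesis by (rule that)
qed

lemma direct_image_adjoint:
  assumes im: "has_images C" and pb: "has_pullbacks C" and g: "g \<in> Hom C E F"
    and N: "N \<in> carrier (Sub C F)"
  obtains P where "P \<in> carrier (Sub C E)"
    "\<And>M. M \<in> carrier (Sub C E) \<Longrightarrow> direct_image C g M \<sqsubseteq>\<^bsub>Sub C F\<^esub> N \<longleftrightarrow> M \<sqsubseteq>\<^bsub>Sub C E\<^esub> P"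
proof -
  obtain n where n: "n \<in> N" using Sub_rep[OF N] .
  obtain p where p: "p \<in> monos_into C E"
    and pull: "\<And>a. \<lbrakk>a \<in> Arr C; Cod C a = E\<rbrakk>
      \<Longrightarrow> factors_through C a p \<longleftrightarrow> factors_through C (g \<cdot> a) n"
    using mono_pullback[OF pb g Sub_repD(1)[OF N n]] by blast
  note P = mono_class_Sub[OF p]
  have "direct_image C g M \<sqsubseteq>\<^bsub>Sub C F\<^esub> N \<longleftrightarrow> M \<sqsubseteq>\<^bsub>Sub C E\<^esub> mono_equiv C E `` {p}"
    if M: "M \<in> carrier (Sub C E)" for M
  proof -
    obtain m where m: "m \<in> M" using Sub_rep[OF M] .
    show ?thesis
      using direct_image_le_iff[OF im g M N m n] Sub_le_iff[OF M P(1) m P(2)]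
        pull[OF Sub_repD(2,3)[OF M m]] by simp
  qed
  then show thesis by (rule that[OF P(1)])
qed

text \<open>The inverse image of \<open>X = (f \<cdot> g)(M)\<close> along \<open>f\<close> contains \<open>g(M)\<close>, because testing this on
  the arrow \<open>g \<cdot> m\<close> amounts to testing whether \<open>f \<cdot> g \<cdot> m\<close> factors through \<open>X\<close>.\<close>

lemma direct_image_Comp_le:
  assumes im: "has_images C" and pb: "has_pullbacks C"
    and g: "g \<in> Hom C E F" and f: "f \<in> Hom C F G" and M: "M \<in> carrier (Sub C E)"
  shows "direct_image C f (direct_image C g M) \<sqsubseteq>\<^bsub>Sub C G\<^esub> direct_image C (f \<cdot> g) M"
proof -
  define X where "X = direct_image C (f \<cdot> g) M"
  have fg: "f \<cdot> g \<in> Hom C E G" by (rule Hom_Comp[OF g f])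
  have X: "X \<in> carrier (Sub C G)" unfolding X_def by (rule direct_image_closed[OF im fg M])
  have gM: "direct_image C g M \<in> carrier (Sub C F)" by (rule direct_image_closed[OF im g M])
  obtain m where m: "m \<in> M" using Sub_rep[OF M] .
  obtain x where x: "x \<in> X" using Sub_rep[OF X] .
  obtain p where p: "p \<in> monos_into C F"
    and pull: "\<And>a. \<lbrakk>a \<in> Arr C; Cod C a = F\<rbrakk>
      \<Longrightarrow> factors_through C a p \<longleftrightarrow> factors_through C (f \<cdot> a) x"
    using mono_pullback[OF pb f Sub_repD(1)[OF X x]] by blast
  note P = mono_class_Sub[OF p]
  obtain y where y: "y \<in> direct_image C g M" using Sub_rep[OF gM] .
  have mA: "m \<in> Arr C" "Cod C m = E" using Sub_repD[OF M m] by auto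
  have "X \<sqsubseteq>\<^bsub>Sub C G\<^esub> X"
    using Sub_le_iff[OF X X x x] factors_refl Sub_repD[OF X x] by simp
  then have "factors_through C ((f \<cdot> g) \<cdot> m) x"
    using direct_image_le_iff[OF im fg M X m x] X_def by simp
  then have "factors_through C (f \<cdot> (g \<cdot> m)) x"
    using Comp_assoc[of m g f] HomD[OF g] HomD[OF f] mA by simp
  then have "factors_through C (g \<cdot> m) p"
    using pull Comp_Arr Comp_Cod HomD[OF g] mA by simp
  then have "direct_image C g M \<sqsubseteq>\<^bsub>Sub C F\<^esub> mono_equiv C F `` {p}"
    using direct_image_le_iff[OF im g M P(1) m P(2)] by simp
  then have "factors_through C (f \<cdot> y) x"
    using Sub_le_iff[OF gM P(1) y P(2)] pull[OF Sub_repD(2,3)[OF gM y]] by simp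
  then show ?thesis
    using direct_image_le_iff[OF im f gM X y x] X_def by simp
qed

text \<open>The half of join preservation that is used below; the bound \<open>X\<close> is transported to the
  domain of \<open>g\<close> along the adjunction.\<close>

lemma direct_image_sup_le:
  assumes im: "has_images C" and pb: "has_pullbacks C" and g: "g \<in> Hom C E F"
    and lat: "complete_lattice (Sub C E)" and A: "A \<subseteq> carrier (Sub C E)"
    and X: "X \<in> carrier (Sub C F)"
    and le: "\<And>M. M \<in> A \<Longrightarrow> direct_image C g M \<sqsubseteq>\<^bsub>Sub C F\<^esub> X"
  shows "direct_image C g (\<Squnion>\<^bsub>Sub C E\<^esub> A) \<sqsubseteq>\<^bsub>Sub C F\<^esub> X"
proof -
  interpret S: complete_lattice "Sub C E" by (rule lat)
  obtain P where P: "P \<in> carrier (Sub C E)"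
    and adj: "\<And>M. M \<in> carrier (Sub C E) \<Longrightarrow> direct_image C g M \<sqsubseteq>\<^bsub>Sub C F\<^esub> X \<longleftrightarrow> M \<sqsubseteq>\<^bsub>Sub C E\<^esub> P"
    using direct_image_adjoint[OF im pb g X] by blast
  have "\<Squnion>\<^bsub>Sub C E\<^esub> A \<sqsubseteq>\<^bsub>Sub C E\<^esub> P"
    using le P A by (intro S.sup_least) (auto simp: Upper_def subset_iff adj[symmetric])
  then show ?thesis using adj[OF S.sup_closed[OF A]] by simp
qed

section \<open>The orbit join as the least invariant subobject\<close>

lemma arr_pow_Hom:
  assumes "E \<in> Obj C" "f \<in> Hom C E E"
  shows "arr_pow C E f k \<in> Hom C E E"
proof (induction k)
  case 0
  then show ?case using assms by (simp add: Hom_def Ident_Arr Ident_Dom Ident_Cod)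
next
  case (Suc k)
  then show ?case using Hom_Comp assms(2) by simp
qed

lemma orbit_subset:
  assumes "has_images C" "E \<in> Obj C" "f \<in> Hom C E E" "M \<in> carrier (Sub C E)"
  shows "range (\<lambda>k::nat. direct_image C (arr_pow C E f k) M) \<subseteq> carrier (Sub C E)"
  using direct_image_closed[OF assms(1) arr_pow_Hom assms(4)] assms(2,3) by blast

lemma orbit_join_closed:
  assumes "has_images C" "complete_lattice (Sub C E)" "E \<in> Obj C" "f \<in> Hom C E E"
    "M \<in> carrier (Sub C E)"
  shows "orbit_join C E f M \<in> carrier (Sub C E)"
proof -
  interpret S: complete_lattice "Sub C E" by (rule assms(2))
  show ?thesis unfolding orbit_join_def using orbit_subset assms by (intro S.sup_closed) auto
qed

lemma direct_image_le_orbit_join: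
  assumes "has_images C" "complete_lattice (Sub C E)" "E \<in> Obj C" "f \<in> Hom C E E"
    "M \<in> carrier (Sub C E)"
  shows "direct_image C (arr_pow C E f k) M \<sqsubseteq>\<^bsub>Sub C E\<^esub> orbit_join C E f M"
proof -
  interpret S: complete_lattice "Sub C E" by (rule assms(2))
  show ?thesis
    unfolding orbit_join_def using orbit_subset assms by (intro S.sup_upper) auto
qed

lemma orbit_join_upper:
  assumes im: "has_images C" and lat: "complete_lattice (Sub C E)" and E: "E \<in> Obj C"
    and f: "f \<in> Hom C E E" and M: "M \<in> carrier (Sub C E)"
  shows "M \<sqsubseteq>\<^bsub>Sub C E\<^esub> orbit_join C E f M"
proof -
  obtain m where m: "m \<in> M" using Sub_rep[OF M] .
  note N = orbit_join_closed[OF im lat E f M]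
  obtain n where n: "n \<in> orbit_join C E f M" using Sub_rep[OF N] .
  have "direct_image C (Ident C E) M \<sqsubseteq>\<^bsub>Sub C E\<^esub> orbit_join C E f M"
    using direct_image_le_orbit_join[OF im lat E f M, of 0] by simp
  then have "factors_through C (Ident C E \<cdot> m) n"
    using direct_image_le_iff[OF im _ M N m n] arr_pow_Hom[OF E f, of 0] by simp
  then show ?thesis
    using Sub_le_iff[OF M N m n] Ident_Comp Sub_repD[OF M m] by force
qed

text \<open>Each term \<open>f\<^sup>k(M)\<close> of the orbit is sent by \<open>f\<close> below the next term, and a bound on the
  images of the terms is a bound on the image of their join.\<close>

lemma orbit_join_invariant:
  assumes im: "has_images C" and pb: "has_pullbacks C" and lat: "complete_lattice (Sub C E)"
    and E: "E \<in> Obj C" and f: "f \<in> Hom C E E" and M: "M \<in> carrier (Sub C E)"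
  shows "direct_image C f (orbit_join C E f M) \<sqsubseteq>\<^bsub>Sub C E\<^esub> orbit_join C E f M"
proof -
  interpret S: complete_lattice "Sub C E" by (rule lat)
  note N = orbit_join_closed[OF im lat E f M]
  have "direct_image C f (direct_image C (arr_pow C E f k) M) \<sqsubseteq>\<^bsub>Sub C E\<^esub> orbit_join C E f M"
    for k
  proof -
    note k = arr_pow_Hom[OF E f, of k]
    have "direct_image C f (direct_image C (arr_pow C E f k) M)
        \<sqsubseteq>\<^bsub>Sub C E\<^esub> direct_image C (arr_pow C E f (Suc k)) M"
      using direct_image_Comp_le[OF im pb k f M] by simp
    then show ?thesis
      by (rule S.le_trans[OF _ direct_image_le_orbit_join[OF im lat E f M]])
        (rule direct_image_closed[OF im f direct_image_closed[OF im k M]]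
          direct_image_closed[OF im arr_pow_Hom[OF E f] M] N)+
  qed
  then have "direct_image C f (\<Squnion>\<^bsub>Sub C E\<^esub> range (\<lambda>k. direct_image C (arr_pow C E f k) M))
      \<sqsubseteq>\<^bsub>Sub C E\<^esub> orbit_join C E f M"
    using direct_image_sup_le[OF im pb f lat orbit_subset[OF im E f M] N] by blast
  then show ?thesis by (simp add: orbit_join_def)
qed

text \<open>Arguing with arrows makes this a plain induction: if \<open>m\<close> and \<open>f \<cdot> n\<close> factor through \<open>n\<close>, then
  inductively so do all the arrows \<open>f\<^sup>k \<cdot> m\<close>.\<close>

lemma orbit_join_least:
  assumes im: "has_images C" and lat: "complete_lattice (Sub C E)" and E: "E \<in> Obj C"
    and f: "f \<in> Hom C E E" and M: "M \<in> carrier (Sub C E)" and N: "N \<in> carrier (Sub C E)"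
    and MN: "M \<sqsubseteq>\<^bsub>Sub C E\<^esub> N" and inv: "direct_image C f N \<sqsubseteq>\<^bsub>Sub C E\<^esub> N"
  shows "orbit_join C E f M \<sqsubseteq>\<^bsub>Sub C E\<^esub> N"
proof -
  interpret S: complete_lattice "Sub C E" by (rule lat)
  obtain m where m: "m \<in> M" using Sub_rep[OF M] .
  obtain n where n: "n \<in> N" using Sub_rep[OF N] .
  have mA: "m \<in> Arr C" "Cod C m = E" using Sub_repD[OF M m] by auto
  have nA: "n \<in> Arr C" "Cod C n = E" using Sub_repD[OF N n] by auto
  have fA: "f \<in> Arr C" "Dom C f = E" "Cod C f = E" using HomD[OF f] by auto
  have fn: "factors_through C (f \<cdot> n) n" using direct_image_le_iff[OF im f N N n n] inv by simp
  have "factors_through C (arr_pow C E f k \<cdot> m) n" for k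
  proof (induction k)
    case 0
    then show ?case using Sub_le_iff[OF M N m n] MN Ident_Comp[OF mA(1)] mA(2) by simp
  next
    case (Suc k)
    have "factors_through C (f \<cdot> (arr_pow C E f k \<cdot> m)) (f \<cdot> n)"
      by (rule factors_Comp[OF fA(1) nA(1) _ Suc.IH]) (simp add: fA nA)
    then have "factors_through C (f \<cdot> (arr_pow C E f k \<cdot> m)) n"
      using factors_trans[OF Comp_Arr[OF nA(1) fA(1)] nA(1) _ fn] fA nA by simp
    then show ?case
      using Comp_assoc[of m "arr_pow C E f k" f] HomD[OF arr_pow_Hom[OF E f, of k]] mA fA by simp
  qed
  then have "direct_image C (arr_pow C E f k) M \<sqsubseteq>\<^bsub>Sub C E\<^esub> N" for k
    using direct_image_le_iff[OF im arr_pow_Hom[OF E f] M N m n] by blast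
  then show ?thesis
    unfolding orbit_join_def using N orbit_subset[OF im E f M]
    by (intro S.sup_least) (auto simp: Upper_def)
qed

end

theorem mainTheorem3:
  fixes C :: "('o, 'a) cat" and E :: 'o and f :: 'a
  assumes "category C" and "has_images C" and "has_pullbacks C"
    and "E \<in> Obj C" and "complete_lattice (Sub C E)"
    and "f \<in> Hom C E E"
  shows "(\<forall>M \<in> carrier (Sub C E). M \<sqsubseteq>\<^bsub>Sub C E\<^esub> orbit_join C E f M) \<and>
    (\<forall>M \<in> carrier (Sub C E). orbit_join C E f (orbit_join C E f M) = orbit_join C E f M) \<and>
    (\<forall>M \<in> carrier (Sub C E). \<forall>M' \<in> carrier (Sub C E).
       orbit_join C E f (M \<squnion>\<^bsub>Sub C E\<^esub> M') = orbit_join C E f M \<squnion>\<^bsub>Sub C E\<^esub> orbit_join C E f M')"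
proof -
  interpret category C by (rule assms(1))
  interpret S: complete_lattice "Sub C E" by (rule assms(5))
  let ?c = "orbit_join C E f"
  note closed = orbit_join_closed[OF assms(2,5,4,6)]
  note upper = orbit_join_upper[OF assms(2,5,4,6)]
  note invariant = orbit_join_invariant[OF assms(2,3,5,4,6)]
  note least = orbit_join_least[OF assms(2,5,4,6)]
  have idem: "?c (?c M) = ?c M" if M: "M \<in> carrier (Sub C E)" for M
    using least[OF closed[OF M] closed[OF M] S.le_refl[OF closed[OF M]] invariant[OF M]]
      upper[OF closed[OF M]] closed[OF closed[OF M]] closed[OF M] by (rule S.le_antisym)
  have mono: "?c M \<sqsubseteq>\<^bsub>Sub C E\<^esub> ?c N"
    if M: "M \<in> carrier (Sub C E)" and N: "N \<in> carrier (Sub C E)" and MN: "M \<sqsubseteq>\<^bsub>Sub C E\<^esub> N" for M N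
    by (rule least[OF M closed[OF N] S.le_trans[OF MN upper[OF N] M N closed[OF N]] invariant[OF N]])
  have join: "?c (M \<squnion>\<^bsub>Sub C E\<^esub> M') = ?c M \<squnion>\<^bsub>Sub C E\<^esub> ?c M'" (is "_ = ?J")
    if M: "M \<in> carrier (Sub C E)" and M': "M' \<in> carrier (Sub C E)" for M M'
  proof (rule S.le_antisym)
    note cM = closed[OF M] and cM' = closed[OF M']
    have MM': "M \<squnion>\<^bsub>Sub C E\<^esub> M' \<in> carrier (Sub C E)" using M M' by (rule S.join_closed)
    have J: "?J \<in> carrier (Sub C E)" using cM cM' by (rule S.join_closed)
    show "?c (M \<squnion>\<^bsub>Sub C E\<^esub> M') \<in> carrier (Sub C E)" "?J \<in> carrier (Sub C E)"
      using closed[OF MM'] J by auto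
    have left: "?c M \<sqsubseteq>\<^bsub>Sub C E\<^esub> ?J" and right: "?c M' \<sqsubseteq>\<^bsub>Sub C E\<^esub> ?J"
      using S.join_left[OF cM cM'] S.join_right[OF cM cM'] by auto
    have "direct_image C f (?c M) \<sqsubseteq>\<^bsub>Sub C E\<^esub> ?J" "direct_image C f (?c M') \<sqsubseteq>\<^bsub>Sub C E\<^esub> ?J"
      using S.le_trans[OF invariant[OF M] left] S.le_trans[OF invariant[OF M'] right]
        direct_image_closed[OF assms(2,6)] cM cM' J by auto
    then have "direct_image C f ?J \<sqsubseteq>\<^bsub>Sub C E\<^esub> ?J"
      using direct_image_sup_le[OF assms(2,3,6,5) _ J, of "{?c M, ?c M'}"] cM cM'
      by (auto simp: join_def)
    moreover have "M \<squnion>\<^bsub>Sub C E\<^esub> M' \<sqsubseteq>\<^bsub>Sub C E\<^esub> ?J"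
      using S.le_trans[OF upper[OF M] left M cM J] S.le_trans[OF upper[OF M'] right M' cM' J]
        M M' J by (rule S.join_le)
    ultimately show "?c (M \<squnion>\<^bsub>Sub C E\<^esub> M') \<sqsubseteq>\<^bsub>Sub C E\<^esub> ?J"
      using least[OF MM' J] by blast
    show "?J \<sqsubseteq>\<^bsub>Sub C E\<^esub> ?c (M \<squnion>\<^bsub>Sub C E\<^esub> M')"
      using mono[OF M MM' S.join_left[OF M M']] mono[OF M' MM' S.join_right[OF M M']]
        cM cM' closed[OF MM'] by (rule S.join_le)
  qed
  show ?thesis using upper idem join by blast
qed

end
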